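(* Let $P$ be Thompson's quandle, with generators $p_0,p_1,p_2,\dots$, and for $j\geqslant 0$ let $P_j$ be the subquandle of $P$ generated by the $p_k$ with $k\geqslant j$. Then $p_j\in P_j\setminus P_{j+1}$ for all $j\geqslant 0$. In particular, the elements $p_j$ of $P$ are all different, and $P$ is infinite.
   Context: A quandle is a set $Q$ with a binary operation $\rhd$ such that for every $x\in Q$ the left multiplication $y\mapsto x\rhd y$ is bijective, $x\rhd(y\rhd z)=(x\rhd y)\rhd(x\rhd z)$ for all $x,y,z$, and $x\rhd x=x$ for all $x$. Thompson's quandle $P$ is the quandle with generators $p_0,p_1,p_2,\dots$ and relations $p_j\rhd p_k=p_{k+1}$ for all $0\leqslant j<k$. A subquandle is a subset closed under $\rhd$ and under the inverses of left multiplications by its elements; $P_0=P$. *)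

theory Defs
  imports Main
begin

locale quandle =
  fixes Q :: "'a set" and rack_op :: "'a \<Rightarrow> 'a \<Rightarrow> 'a" (infixr "\<rhd>" 70)
  assumes bij_left: "x \<in> Q \<Longrightarrow> bij_betw (\<lambda>y. x \<rhd> y) Q Q"
    and left_distrib: "\<lbrakk>x \<in> Q; y \<in> Q; z \<in> Q\<rbrakk> \<Longrightarrow> x \<rhd> (y \<rhd> z) = (x \<rhd> y) \<rhd> (x \<rhd> z)"
    and idem: "x \<in> Q \<Longrightarrow> x \<rhd> x = x"

definition subquandle :: "'a set \<Rightarrow> ('a \<Rightarrow> 'a \<Rightarrow> 'a) \<Rightarrow> 'a set \<Rightarrow> bool" where
  "subquandle Q f S \<longleftrightarrow>
     S \<subseteq> Q \<and> (\<forall>x\<in>S. \<forall>y\<in>S. f x y \<in> S) \<and> (\<forall>x\<in>S. \<forall>y\<in>S. inv_into Q (f x) y \<in> S)"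

definition generated_subquandle :: "'a set \<Rightarrow> ('a \<Rightarrow> 'a \<Rightarrow> 'a) \<Rightarrow> 'a set \<Rightarrow> 'a set" where
  "generated_subquandle Q f A = \<Inter>{S. subquandle Q f S \<and> A \<subseteq> S}"

text \<open>
  Formal quandle words over a set of generators; \<open>QInv x y\<close> stands for the image of \<open>y\<close> under
  the inverse of the left multiplication by \<open>x\<close>. The quandle presented by a set \<open>R\<close> of pairs of
  words is the quotient of the words by the smallest congruence that contains \<open>R\<close> and all
  instances of the quandle axioms.
\<close>

datatype 'g qterm = QGen 'g | QOp "'g qterm" "'g qterm" | QInv "'g qterm" "'g qterm"

inductive qcong :: "('g qterm \<times> 'g qterm) set \<Rightarrow> 'g qterm \<Rightarrow> 'g qterm \<Rightarrow> bool"
  for R :: "('g qterm \<times> 'g qterm) set" where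
  qrefl: "qcong R s s"
| qsym: "qcong R s t \<Longrightarrow> qcong R t s"
| qtrans: "qcong R s t \<Longrightarrow> qcong R t u \<Longrightarrow> qcong R s u"
| qcong_op: "qcong R s s' \<Longrightarrow> qcong R t t' \<Longrightarrow> qcong R (QOp s t) (QOp s' t')"
| qcong_inv: "qcong R s s' \<Longrightarrow> qcong R t t' \<Longrightarrow> qcong R (QInv s t) (QInv s' t')"
| qop_inv: "qcong R (QOp s (QInv s t)) t"
| qinv_op: "qcong R (QInv s (QOp s t)) t"
| qdistrib: "qcong R (QOp s (QOp t u)) (QOp (QOp s t) (QOp s u))"
| qidem: "qcong R (QOp s s) s"
| qrel: "(s, t) \<in> R \<Longrightarrow> qcong R s t"

lemma equivp_qcong: "equivp (qcong R)"
  by (rule equivpI) (auto intro!: reflpI sympI transpI intro: qcong.qrefl qcong.qsym qcong.qtrans)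

definition thompson_rels :: "(nat qterm \<times> nat qterm) set" where
  "thompson_rels = {(QOp (QGen j) (QGen k), QGen (k + 1)) | j k. j < k}"

quotient_type thompson = "nat qterm" / "qcong thompson_rels"
  by (rule equivp_qcong)

lift_definition thompson_op :: "thompson \<Rightarrow> thompson \<Rightarrow> thompson" (infixr "\<rhd>\<^sub>P" 70) is QOp
  by (rule qcong_op)

lift_definition thompson_inv :: "thompson \<Rightarrow> thompson \<Rightarrow> thompson" is QInv
  by (rule qcong_inv)

lift_definition thompson_gen :: "nat \<Rightarrow> thompson" is QGen .

definition thompson_sub :: "nat \<Rightarrow> thompson set" where
  "thompson_sub j = generated_subquandle UNIV (\<rhd>\<^sub>P) {thompson_gen k | k. j \<le> k}"

lemma thompson_op_inv: "x \<rhd>\<^sub>P thompson_inv x y = y"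
  by transfer (rule qop_inv)

lemma thompson_inv_op: "thompson_inv x (x \<rhd>\<^sub>P y) = y"
  by transfer (rule qinv_op)

lemma thompson_relation: "j < k \<Longrightarrow> thompson_gen j \<rhd>\<^sub>P thompson_gen k = thompson_gen (k + 1)"
  by transfer (auto intro!: qrel simp: thompson_rels_def)

lemma bij_thompson_op: "bij ((\<rhd>\<^sub>P) x)"
  by (metis bijI' thompson_op_inv thompson_inv_op)

lemma quandle_thompson: "quandle UNIV (\<rhd>\<^sub>P)"
proof
  show "bij ((\<rhd>\<^sub>P) x)" for x by (rule bij_thompson_op)
  show "x \<rhd>\<^sub>P y \<rhd>\<^sub>P z = (x \<rhd>\<^sub>P y) \<rhd>\<^sub>P x \<rhd>\<^sub>P z" for x y z
    by transfer (rule qdistrib)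
  show "x \<rhd>\<^sub>P x = x" for x by transfer (rule qidem)
qed

lemma inv_thompson_op: "inv ((\<rhd>\<^sub>P) x) y = thompson_inv x y"
  by (metis bij_thompson_op bij_inv_eq_iff thompson_op_inv)

lemma thompson_induct [case_names gen op inv]:
  assumes "\<And>k. A (thompson_gen k)"
    and "\<And>x y. A x \<Longrightarrow> A y \<Longrightarrow> A (x \<rhd>\<^sub>P y)"
    and "\<And>x y. A x \<Longrightarrow> A y \<Longrightarrow> A (thompson_inv x y)"
  shows "A x"
proof -
  have "A (abs_thompson t)" for t
    by (induction t) (use assms in \<open>simp_all flip: thompson_gen.abs_eq thompson_op.abs_eq thompson_inv.abs_eq\<close>)
  then show ?thesis
    by (metis Quotient_abs_rep Quotient_thompson)
qed

lemma thompson_sub_0: "thompson_sub 0 = UNIV"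
proof -
  have "x \<in> S" if S: "subquandle UNIV (\<rhd>\<^sub>P) S" "range thompson_gen \<subseteq> S" for x S
    by (induction x rule: thompson_induct)
      (use S in \<open>auto simp: subquandle_def inv_thompson_op\<close>)
  then show ?thesis
    by (auto simp: thompson_sub_def generated_subquandle_def full_SetCompr_eq)
qed

primrec qeval :: "'a set \<Rightarrow> ('a \<Rightarrow> 'a \<Rightarrow> 'a) \<Rightarrow> ('g \<Rightarrow> 'a) \<Rightarrow> 'g qterm \<Rightarrow> 'a" where
  "qeval Q f g (QGen k) = g k"
| "qeval Q f g (QOp s t) = f (qeval Q f g s) (qeval Q f g t)"
| "qeval Q f g (QInv s t) = inv_into Q (f (qeval Q f g s)) (qeval Q f g t)"

lemma thompson_universal:
  assumes Q: "quandle Q f"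
    and g: "\<And>k. g k \<in> Q"
    and rel: "\<And>j k. j < k \<Longrightarrow> f (g j) (g k) = g (k + 1)"
  shows "\<exists>!h. range h \<subseteq> Q \<and> (\<forall>x y. h (x \<rhd>\<^sub>P y) = f (h x) (h y)) \<and> (\<forall>k. h (thompson_gen k) = g k)"
proof -
  interpret quandle Q f by (rule Q)
  let ?e = "qeval Q f g"
  have op_in: "f x y \<in> Q" if "x \<in> Q" "y \<in> Q" for x y
    using bij_left[OF that(1)] that(2) by (auto simp: bij_betw_def)
  have inv_in: "inv_into Q (f x) y \<in> Q" if "x \<in> Q" "y \<in> Q" for x y
    using bij_left[OF that(1)] that(2) by (auto simp: bij_betw_def intro: inv_into_into)
  have op_inv: "f x (inv_into Q (f x) y) = y" if "x \<in> Q" "y \<in> Q" for x y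
    using bij_left[OF that(1)] that(2) by (simp add: bij_betw_def f_inv_into_f)
  have inv_op: "inv_into Q (f x) (f x y) = y" if "x \<in> Q" "y \<in> Q" for x y
    using bij_left[OF that(1)] that(2) by (simp add: bij_betw_def)
  have e_in: "?e t \<in> Q" for t
    by (induction t) (auto simp: g op_in inv_in)
  have e_cong: "?e s = ?e t" if "qcong thompson_rels s t" for s t
    using that
    by induction (auto simp: e_in op_inv inv_op left_distrib idem thompson_rels_def rel[simplified])
  define h where "h x = ?e (rep_thompson x)" for x
  have h_abs: "h (abs_thompson t) = ?e t" for t
    unfolding h_def by (rule e_cong) (rule rep_abs_rsp_left[OF Quotient3_thompson qrefl])
  have abs_ex: "\<exists>t. x = abs_thompson t" for x
    by (metis Quotient_abs_rep Quotient_thompson)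
  show ?thesis
  proof (rule ex1I[of _ h])
    have "h (x \<rhd>\<^sub>P y) = f (h x) (h y)" for x y
      using abs_ex[of x] abs_ex[of y] by (auto simp: thompson_op.abs_eq h_abs)
    then show "range h \<subseteq> Q \<and> (\<forall>x y. h (x \<rhd>\<^sub>P y) = f (h x) (h y)) \<and> (\<forall>k. h (thompson_gen k) = g k)"
      by (auto simp: h_def e_in) (simp add: h_abs thompson_gen.abs_eq flip: h_def)
  next
    fix h'
    assume h': "range h' \<subseteq> Q \<and> (\<forall>x y. h' (x \<rhd>\<^sub>P y) = f (h' x) (h' y)) \<and> (\<forall>k. h' (thompson_gen k) = g k)"
    then have in': "h' x \<in> Q" for x by auto
    have inv': "h' (thompson_inv x y) = inv_into Q (f (h' x)) (h' y)" for x y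
      by (metis h' in' inv_op thompson_op_inv)
    have "h' (abs_thompson t) = ?e t" for t
      by (induction t)
        (use h' inv' in \<open>simp_all flip: thompson_gen.abs_eq thompson_op.abs_eq thompson_inv.abs_eq\<close>)
    then show "h' = h"
      using abs_ex h_abs by (metis ext)
  qed
qed

end

theory Submission imports Defs Complex_Main begin

text \<open>
  The relation \<open>p\<^sub>j \<rhd> p\<^sub>k = p\<^sub>k\<^sub>+\<^sub>1\<close> is the defining relation of Thompson's group \<open>F\<close> if \<open>\<rhd>\<close> is read as
  conjugation, so every action of \<open>F\<close> on a set makes \<open>P\<close> map to the conjugation quandle of the
  bijections of that set. Take the action of \<open>F\<close> on the line by piecewise linear
  homeomorphisms, where the \<open>n\<close>-th generator is the identity up to \<open>n\<close>, has slope \<open>2\<close> on the interval from \<open>n\<close> to \<open>n + 1\<close>, and is the translation by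
  \<open>1\<close> from there on (\<open>stretch_conj\<close>). The elements of \<open>P\<close> whose image fixes every point up to \<open>m\<close>
  form a subquandle (\<open>subquandle_fixing\<close>). For \<open>m = j + 1\<close> it contains all \<open>p\<^sub>k\<close> with \<open>k > j\<close>, hence
  \<open>P\<^sub>j\<^sub>+\<^sub>1\<close>; but the image of \<open>p\<^sub>j\<close> moves the point \<open>j + 1\<close>, so \<open>p\<^sub>j\<close> is outside \<open>P\<^sub>j\<^sub>+\<^sub>1\<close>. If \<open>i < j\<close>, then
  \<open>p\<^sub>j\<close> lies in \<open>P\<^sub>i\<^sub>+\<^sub>1\<close> while \<open>p\<^sub>i\<close> does not, so the generators are distinct and \<open>P\<close> is infinite.
\<close>

definition conj_op :: "('a \<Rightarrow> 'a) \<Rightarrow> ('a \<Rightarrow> 'a) \<Rightarrow> 'a \<Rightarrow> 'a" where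
  "conj_op a b = a \<circ> b \<circ> inv a"

lemma conj_op_apply: "bij a \<Longrightarrow> conj_op a b (a t) = a (b t)"
  by (simp add: conj_op_def bij_is_inj)

lemma quandle_conj_op: "quandle {a. bij a} conj_op"
proof
  fix a :: "'a \<Rightarrow> 'a" assume "a \<in> {a. bij a}"
  then have a: "bij a" by simp
  show "bij_betw (conj_op a) {a. bij a} {a. bij a}"
  proof (rule bij_betw_byWitness[where f' = "\<lambda>b. inv a \<circ> b \<circ> a"])
    show "\<forall>b\<in>{a. bij a}. inv a \<circ> conj_op a b \<circ> a = b"
      using a by (simp add: conj_op_def fun_eq_iff bij_is_inj)
    show "\<forall>b\<in>{a. bij a}. conj_op a (inv a \<circ> b \<circ> a) = b"
      using a by (simp add: conj_op_def fun_eq_iff bij_is_surj surj_f_inv_f)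
  qed (use a in \<open>auto simp: conj_op_def bij_imp_bij_inv intro!: bij_comp\<close>)
  show "conj_op a a = a"
    using a by (simp add: conj_op_def fun_eq_iff bij_is_surj surj_f_inv_f)
  fix b c :: "'a \<Rightarrow> 'a" assume "b \<in> {a. bij a}" "c \<in> {a. bij a}"
  then have b: "bij b" by simp
  have ab: "bij (conj_op a b)"
    unfolding conj_op_def using a b by (intro bij_comp bij_imp_bij_inv)
  show "conj_op a (conj_op b c) = conj_op (conj_op a b) (conj_op a c)"
  proof
    fix t
    \<comment> \<open>At the points \<open>a (b s)\<close>, which are all points, no inverses need to be computed.\<close>
    obtain s where "t = a (b s)"
      using a b by (metis bij_pointE)
    then show "conj_op a (conj_op b c) t = conj_op (conj_op a b) (conj_op a c) t"
      using conj_op_apply[OF ab, of "conj_op a c" "a s"] a b by (simp add: conj_op_apply)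
  qed
qed

definition stretch :: "nat \<Rightarrow> real \<Rightarrow> real" where
  "stretch n t = (if t \<le> n then t else if t \<le> n + 1 then 2 * t - n else t + 1)"

lemma bij_stretch: "bij (stretch n)"
proof (rule bijI)
  show "inj (stretch n)"
    by (rule injI) (auto simp: stretch_def split: if_splits)
  have "stretch n (if t \<le> n then t else if t \<le> n + 2 then (t + n) / 2 else t - 1) = t" for t :: real
    by (auto simp: stretch_def field_simps)
  then show "surj (stretch n)"
    by (rule surjI)
qed

text \<open>
  To the left of \<open>j + 1\<close> both \<open>stretch k\<close> and, after \<open>stretch j\<close>, \<open>stretch (k + 1)\<close> act trivially. To
  the right of it \<open>stretch j\<close> is the translation by \<open>1\<close>, which carries \<open>stretch k\<close> to \<open>stretch (k + 1)\<close>.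
\<close>

lemma stretch_commute:
  assumes "j < k"
  shows "stretch j (stretch k t) = stretch (k + 1) (stretch j t)"
proof -
  have "real j + 1 \<le> real k" using assms by linarith
  then show ?thesis by (auto simp: stretch_def)
qed

lemma stretch_conj:
  assumes "j < k"
  shows "conj_op (stretch j) (stretch k) = stretch (k + 1)"
proof
  fix t
  obtain s where "t = stretch j s"
    using bij_stretch by (metis bij_pointE)
  then show "conj_op (stretch j) (stretch k) t = stretch (k + 1) t"
    using stretch_commute[OF assms] by (simp add: conj_op_apply bij_stretch)
qed

text \<open>
  The pointwise stabilizer of \<open>A\<close> is a subgroup; this is its preimage under the quandle
  homomorphism \<open>h\<close>.
\<close>

lemma subquandle_fixing:
  assumes bij: "\<And>x. bij (h x)"
    and hom: "\<And>x y. h (x \<rhd>\<^sub>P y) = conj_op (h x) (h y)"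
  shows "subquandle UNIV (\<rhd>\<^sub>P) {x. \<forall>t\<in>A. h x t = t}"
proof -
  have op: "h (x \<rhd>\<^sub>P y) t = t" if "h x t = t" "h y t = t" for x y t
    using conj_op_apply[OF bij, of x "h y" t] that by (simp add: hom)
  have inv: "h (thompson_inv x y) t = t" if "h x t = t" "h y t = t" for x y t
  proof -
    have "h x (h (thompson_inv x y) t) = h (x \<rhd>\<^sub>P thompson_inv x y) (h x t)"
      by (simp add: hom conj_op_apply bij)
    also have "\<dots> = h x t"
      using that by (simp add: thompson_op_inv)
    finally show ?thesis
      using bij by (meson bij_is_inj injD)
  qed
  show ?thesis
    using op inv by (auto simp: subquandle_def inv_thompson_op)
qed

lemma thompson_gen_in_sub: "j \<le> k \<Longrightarrow> thompson_gen k \<in> thompson_sub j"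
  by (auto simp: thompson_sub_def generated_subquandle_def)

lemma thompson_gen_notin_sub: "thompson_gen j \<notin> thompson_sub (j + 1)"
proof
  assume in_sub: "thompson_gen j \<in> thompson_sub (j + 1)"
  have "\<exists>h. range h \<subseteq> {a. bij a} \<and> (\<forall>x y. h (x \<rhd>\<^sub>P y) = conj_op (h x) (h y))
      \<and> (\<forall>k. h (thompson_gen k) = stretch k)"
    by (rule ex1_implies_ex, rule thompson_universal[OF quandle_conj_op])
      (simp_all only: mem_Collect_eq bij_stretch stretch_conj)
  then obtain h where h: "range h \<subseteq> {a. bij a}"
    and hom: "\<forall>x y. h (x \<rhd>\<^sub>P y) = conj_op (h x) (h y)"
    and gen: "\<forall>k. h (thompson_gen k) = stretch k"
    by (elim exE conjE)
  have bij: "bij (h x)" for x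
    using h by auto
  let ?S = "{x. \<forall>t\<in>{..real j + 1}. h x t = t}"
  have "subquandle UNIV (\<rhd>\<^sub>P) ?S"
    using bij hom[rule_format] by (rule subquandle_fixing)
  moreover have "{thompson_gen k |k. j + 1 \<le> k} \<subseteq> ?S"
    by (auto simp: gen stretch_def)
  ultimately have "thompson_gen j \<in> ?S"
    using in_sub unfolding thompson_sub_def generated_subquandle_def by blast
  then have "stretch j (real j + 1) = real j + 1"
    by (simp add: gen)
  then show False
    by (simp add: stretch_def)
qed

theorem mainTheorem3:
  shows "(\<forall>j. thompson_gen j \<in> thompson_sub j - thompson_sub (j + 1))
    \<and> inj thompson_gen
    \<and> infinite (UNIV :: thompson set)"
proof -
  have "thompson_gen i \<noteq> thompson_gen j" if "i < j" for i j
    using thompson_gen_notin_sub[of i] thompson_gen_in_sub[of "i + 1" j] that by auto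
  then have inj: "inj thompson_gen"
    by (rule linorder_injI)
  moreover have "infinite (UNIV :: thompson set)"
    using inj by (auto simp: infinite_iff_countable_subset)
  ultimately show ?thesis
    by (simp add: thompson_gen_in_sub thompson_gen_notin_sub[simplified])
qed

end
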